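(* Let $n\ge 3$ and let $(C_n,\mathbf{w})$ be a cycle with positive integer edge weights $w_1,\dots,w_n$ satisfying the triangle inequality (each edge weight is at most the sum of the other edge weights, i.e. every edge is a shortest path between its endpoints). Then $c(C_n,\mathbf{w})=\left\lceil \frac{\sum_{i=1}^{n} w_i}{2}\right\rceil$.
   Context: $d_\mathbf{w}(u,v)$ is the minimum total weight of a $(u,v)$-path. A binary addressing of length $m$ is a map $f:V\to\{0,1\}^m$ with $d_\mathbf{w}(u,v)\le d_H(f(u),f(v))$ for all vertices $u,v$ ($d_H$ the Hamming distance); $c(G,\mathbf{w})$ is the minimum length of a binary addressing. *)

theory Defs
  imports "Graph_Theory.Graph_Theory" Complex_Main
begin

text \<open>
  Undirected graphs are symmetric digraphs, as in the library locale \<open>graph\<close>: the two arcs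
  \<open>(u, v)\<close> and \<open>(v, u)\<close> together represent the single edge \<open>{u, v}\<close>. Weights are attached to
  these unordered edges, so both arcs automatically carry the same weight.
\<close>

definition edge_of :: "('a, 'b) pre_digraph \<Rightarrow> 'b \<Rightarrow> 'a set" where
  "edge_of G a = {tail G a, head G a}"

definition edges :: "('a, 'b) pre_digraph \<Rightarrow> 'a set set" where
  "edges G = edge_of G ` arcs G"

definition path_weight :: "('a, 'b) pre_digraph \<Rightarrow> ('a set \<Rightarrow> nat) \<Rightarrow> 'b awalk \<Rightarrow> nat" where
  "path_weight G w p = (\<Sum>a\<leftarrow>p. w (edge_of G a))"

text \<open>
  The predicate \<open>apath\<close> describes paths without repeated vertices. As a \<open>LEAST\<close> over the naturals,
  the distance is meaningful only if a path from \<open>u\<close> to \<open>v\<close> exists, hence for all pairs of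
  vertices of a connected graph.
\<close>

definition wdist :: "('a, 'b) pre_digraph \<Rightarrow> ('a set \<Rightarrow> nat) \<Rightarrow> 'a \<Rightarrow> 'a \<Rightarrow> nat" where
  "wdist G w u v = (LEAST d. \<exists>p. pre_digraph.apath G u p v \<and> path_weight G w p = d)"

definition hamming_dist :: "'c list \<Rightarrow> 'c list \<Rightarrow> nat" where
  "hamming_dist xs ys = card {i. i < length xs \<and> xs ! i \<noteq> ys ! i}"

text \<open>The words in \<open>{0,1}\<^sup>m\<close> are the Boolean lists of length \<open>m\<close>.\<close>

definition binary_addressing ::
  "('a, 'b) pre_digraph \<Rightarrow> ('a set \<Rightarrow> nat) \<Rightarrow> nat \<Rightarrow> ('a \<Rightarrow> bool list) \<Rightarrow> bool" where
  "binary_addressing G w m f \<longleftrightarrow>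
     (\<forall>v\<in>verts G. length (f v) = m) \<and>
     (\<forall>u\<in>verts G. \<forall>v\<in>verts G. wdist G w u v \<le> hamming_dist (f u) (f v))"

definition addressing_number :: "('a, 'b) pre_digraph \<Rightarrow> ('a set \<Rightarrow> nat) \<Rightarrow> nat" where
  "addressing_number G w = (LEAST m. \<exists>f. binary_addressing G w m f)"

definition cycle_graph :: "nat \<Rightarrow> nat pair_pre_digraph" where
  "cycle_graph n = \<lparr> pverts = {..<n},
     parcs = {(u, v). u < n \<and> v < n \<and> (v = Suc u mod n \<or> u = Suc v mod n)} \<rparr>"

lemma pair_graph_cycle_graph:
  assumes "n \<ge> 3"
  shows "pair_graph (cycle_graph n)"
proof
  have "parcs (cycle_graph n) \<subseteq> {..<n} \<times> {..<n}"
    by (auto simp: cycle_graph_def)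
  then show "finite (parcs (cycle_graph n))"
    by (rule finite_subset) simp
  show "fst e \<noteq> snd e" if "e \<in> parcs (cycle_graph n)" for e
    using that assms by (auto simp: cycle_graph_def mod_Suc split: if_splits)
  show "symmetric (with_proj (cycle_graph n))"
    by (auto simp: cycle_graph_def symmetric_def intro!: symI)
qed (auto simp: cycle_graph_def)

lemma edges_cycle_graph:
  "edges (with_proj (cycle_graph n)) = (\<lambda>i. {i, Suc i mod n}) ` {..<n}"
proof (intro equalityI subsetI)
  fix e assume "e \<in> edges (with_proj (cycle_graph n))"
  then show "e \<in> (\<lambda>i. {i, Suc i mod n}) ` {..<n}"
    by (auto simp: edges_def edge_of_def cycle_graph_def image_iff insert_commute)
next
  fix e assume "e \<in> (\<lambda>i. {i, Suc i mod n}) ` {..<n}"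
  then obtain i where "i < n" "e = {i, Suc i mod n}"
    by auto
  then show "e \<in> edges (with_proj (cycle_graph n))"
    unfolding edges_def
    by (intro image_eqI[where x = "(i, Suc i mod n)"]) (auto simp: edge_of_def cycle_graph_def)
qed

lemma inj_on_cycle_graph_edges:
  assumes "n \<ge> 3"
  shows "inj_on (\<lambda>i. {i, Suc i mod n}) {..<n}"
  using assms by (auto simp: inj_on_def doubleton_eq_iff mod_Suc split: if_splits)

end

theory Submission
  imports Defs
begin

text \<open>
  Lay the cycle out on a circle of circumference \<open>S\<close>, the total weight; the weighted distance is
  then the circular distance.

  Lower bound: each edge has length at most \<open>S / 2\<close>, so some three vertices cut the circle into
  arcs of length at most \<open>S / 2\<close>, and their pairwise distances add up to \<open>S\<close>. A single
  coordinate contributes at most 2 to the sum of the pairwise Hamming distances of three binary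
  words, hence \<open>S \<le> 2 m\<close>.

  Upper bound: with \<open>m = \<lceil>S / 2\<rceil>\<close>, the even cycle of length \<open>2 m \<ge> S\<close> embeds isometrically
  into \<open>{0,1}\<^sup>m\<close>, and placing the vertices on it at their positions on the circle of
  circumference \<open>S\<close> does not decrease distances.
\<close>

section \<open>Distance along a circle\<close>

text \<open>Subtraction truncates at 0, so \<open>(x - y) + (y - x)\<close> is the absolute
  difference. The points \<open>0\<close> and \<open>S\<close> coincide on the circle.\<close>

definition circ_dist :: "nat \<Rightarrow> nat \<Rightarrow> nat \<Rightarrow> nat" where
  "circ_dist S x y = min ((x - y) + (y - x)) (S - ((x - y) + (y - x)))"

lemma circ_dist_commute: "circ_dist S x y = circ_dist S y x"
  by (simp add: circ_dist_def add.commute)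

lemma circ_dist_le: "x \<le> y \<Longrightarrow> circ_dist S x y = min (y - x) (S - (y - x))"
  by (simp add: circ_dist_def)

text \<open>Each of the three gaps is at most the sum of the other two, and together they are at
  most \<open>2 * S\<close>; the last bound handles the case where both right-hand distances are
  complementary arcs.\<close>

lemma circ_dist_triangle:
  assumes "x \<le> S" "y \<le> S" "z \<le> S"
  shows "circ_dist S x z \<le> circ_dist S x y + circ_dist S y z"
proof -
  define a b c where abc: "a = (x - y) + (y - x)" "b = (y - z) + (z - y)" "c = (x - z) + (z - x)"
  have "c \<le> a + b" "a \<le> b + c" "b \<le> a + c" "a \<le> S" "b \<le> S" "a + b + c \<le> 2 * S"
    using assms unfolding abc by linarith+
  then have "min c (S - c) \<le> min a (S - a) + min b (S - b)"
    by (simp add: min_def) linarith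
  then show ?thesis
    by (simp add: circ_dist_def abc)
qed

section \<open>Weighted distances\<close>

context wf_digraph
begin

text \<open>Cutting a cycle out of a walk cannot raise its weight. Distances can thus be bounded by
  concatenated walks without checking for repeated vertices.\<close>

lemma apath_of_awalk:
  assumes "awalk u p v"
  obtains q where "apath u q v" "path_weight G w q \<le> path_weight G w p"
proof -
  from assms have "\<exists>q. apath u q v \<and> path_weight G w q \<le> path_weight G w p"
  proof (induction rule: awalk_to_apath_induct)
    case (path p)
    then show ?case by (auto simp: apath_def)
  next
    case (decomp p q r s)
    then have "p = q @ r @ s"
      by (auto elim: awalk_cyc_decompE)
    then have "path_weight G w (q @ s) \<le> path_weight G w p"
      by (simp add: path_weight_def)
    with decomp.IH show ?case
      using order_trans by blast
  qed
  with that show thesis by blast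
qed

lemma wdist_le_path_weight:
  assumes "awalk u p v"
  shows "wdist G w u v \<le> path_weight G w p"
proof -
  obtain q where q: "apath u q v" "path_weight G w q \<le> path_weight G w p"
    using apath_of_awalk[OF assms] .
  then have "wdist G w u v \<le> path_weight G w q"
    unfolding wdist_def by (intro Least_le) blast
  with q show ?thesis by simp
qed

text \<open>Along a walk, the triangle inequality bounds \<open>D\<close> by the sum of its values
  on the arcs, hence by the weight.\<close>

lemma le_wdist:
  fixes D :: "'a \<Rightarrow> 'a \<Rightarrow> nat"
  assumes walk: "awalk u p v"
    and refl: "\<And>x. x \<in> verts G \<Longrightarrow> D x x = 0"
    and triangle: "\<And>x y z. \<lbrakk>x \<in> verts G; y \<in> verts G; z \<in> verts G\<rbrakk> \<Longrightarrow> D x z \<le> D x y + D y z"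
    and edge: "\<And>a. a \<in> arcs G \<Longrightarrow> D (tail G a) (head G a) \<le> w (edge_of G a)"
  shows "D u v \<le> wdist G w u v"
proof -
  have bound: "D x v \<le> path_weight G w q" if "awalk x q v" for x q
    using that
  proof (induction q arbitrary: x)
    case Nil
    then show ?case using refl[of v] by (auto simp: awalk_Nil_iff)
  next
    case (Cons a q)
    then have a: "a \<in> arcs G" "x = tail G a" and q: "awalk (head G a) q v"
      by (auto simp: awalk_Cons_iff)
    then have "D x v \<le> D (tail G a) (head G a) + D (head G a) v"
      using triangle awalk_last_in_verts by simp
    also have "\<dots> \<le> w (edge_of G a) + path_weight G w q"
      using edge[OF a(1)] Cons.IH[OF q] by (rule add_mono)
    finally show ?case by (simp add: path_weight_def)
  qed
  obtain q where "apath u q v"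
    using apath_of_awalk[OF walk] .
  \<comment> \<open>The \<open>LEAST\<close> in \<open>wdist\<close> is attained because some path
    exists.\<close>
  then have "\<exists>d q. apath u q v \<and> path_weight G w q = d"
    by blast
  then have "\<exists>q. apath u q v \<and> path_weight G w q = wdist G w u v"
    unfolding wdist_def by (rule LeastI_ex)
  then show ?thesis
    using bound awalkI_apath by metis
qed

end

section \<open>The cycle as a circle\<close>

text \<open>Vertex \<open>k\<close> sits at this position, measured from vertex 0;
  \<open>k = n\<close> closes the circle and gives its circumference.\<close>

definition cycle_pos :: "nat \<Rightarrow> (nat set \<Rightarrow> nat) \<Rightarrow> nat \<Rightarrow> nat" where
  "cycle_pos n w k = (\<Sum>i<k. w {i, Suc i mod n})"

lemma cycle_pos_0: "cycle_pos n w 0 = 0"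
  by (simp add: cycle_pos_def)

lemma cycle_pos_Suc: "cycle_pos n w (Suc k) = cycle_pos n w k + w {k, Suc k mod n}"
  by (simp add: cycle_pos_def)

lemma cycle_pos_mono: "j \<le> k \<Longrightarrow> cycle_pos n w j \<le> cycle_pos n w k"
  unfolding cycle_pos_def by (rule sum_mono2) auto

lemma cycle_pos_total:
  assumes "n \<ge> 3"
  shows "(\<Sum>e \<in> edges (with_proj (cycle_graph n)). w e) = cycle_pos n w n"
  by (simp add: edges_cycle_graph sum.reindex[OF inj_on_cycle_graph_edges[OF assms]]
      cycle_pos_def)

lemma wf_digraph_cycle_graph:
  assumes "n \<ge> 3"
  shows "wf_digraph (with_proj (cycle_graph n))"
proof -
  interpret pair_graph "cycle_graph n"
    using assms by (rule pair_graph_cycle_graph)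
  show ?thesis by unfold_locales
qed

text \<open>These walks follow the arc through \<open>u, ..., v\<close>, which avoids the closing
  edge between \<open>n - 1\<close> and 0.\<close>

lemma cycle_walks_up:
  fixes w :: "nat set \<Rightarrow> nat"
  assumes n: "n \<ge> 3" and "u \<le> v" "v < n"
  defines "G \<equiv> with_proj (cycle_graph n)"
  shows "\<exists>p q. pre_digraph.awalk G u p v \<and> pre_digraph.awalk G v q u \<and>
    path_weight G w p = cycle_pos n w v - cycle_pos n w u \<and>
    path_weight G w q = cycle_pos n w v - cycle_pos n w u"
  using assms(2,3)
proof (induction v rule: dec_induct)
  interpret wf_digraph G
    unfolding G_def using n by (rule wf_digraph_cycle_graph)
  case base
  then have "awalk u [] u"
    unfolding awalk_Nil_iff by (simp add: G_def cycle_graph_def)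
  then show ?case
    by (intro exI[of _ "[]"]) (simp add: path_weight_def)
next
  interpret wf_digraph G
    unfolding G_def using n by (rule wf_digraph_cycle_graph)
  case (step k)
  then obtain p q where p: "awalk u p k" "path_weight G w p = cycle_pos n w k - cycle_pos n w u"
    and q: "awalk k q u" "path_weight G w q = cycle_pos n w k - cycle_pos n w u"
    by auto
  have "awalk k [(k, Suc k)] (Suc k)" "awalk (Suc k) [(Suc k, k)] k"
    using step.prems unfolding awalk_simps by (auto simp: G_def cycle_graph_def)
  then have "awalk u (p @ [(k, Suc k)]) (Suc k)" "awalk (Suc k) ((Suc k, k) # q) u"
    using p(1) q(1) awalk_appendI by (blast, fastforce simp: awalk_simps)
  moreover have "path_weight G w (p @ [(k, Suc k)]) = cycle_pos n w (Suc k) - cycle_pos n w u"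
    "path_weight G w ((Suc k, k) # q) = cycle_pos n w (Suc k) - cycle_pos n w u"
    using p(2) q(2) step.hyps step.prems cycle_pos_mono[of u k n w]
    by (simp_all add: path_weight_def cycle_pos_Suc edge_of_def G_def insert_commute)
  ultimately show ?case by blast
qed

text \<open>The complementary arc: from \<open>u\<close> down to 0, over the closing edge to
  \<open>n - 1\<close>, then down to \<open>v\<close>, and the same in reverse.\<close>

lemma cycle_walks_around:
  fixes w :: "nat set \<Rightarrow> nat"
  assumes n: "n \<ge> 3" and "u \<le> v" "v < n"
  defines "G \<equiv> with_proj (cycle_graph n)"
  shows "\<exists>p q. pre_digraph.awalk G u p v \<and> pre_digraph.awalk G v q u \<and>
    path_weight G w p = cycle_pos n w n - (cycle_pos n w v - cycle_pos n w u) \<and>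
    path_weight G w q = cycle_pos n w n - (cycle_pos n w v - cycle_pos n w u)"
proof -
  interpret wf_digraph G
    unfolding G_def using n by (rule wf_digraph_cycle_graph)
  define l where "l = n - 1"
  have l: "v \<le> l" "l < n" "Suc l = n"
    using assms by (auto simp: l_def)
  obtain p1 q1 where 1: "awalk 0 p1 u" "awalk u q1 0"
    "path_weight G w p1 = cycle_pos n w u" "path_weight G w q1 = cycle_pos n w u"
    using cycle_walks_up[OF n, of 0 u w] assms by (auto simp: G_def cycle_pos_0)
  obtain p2 q2 where 2: "awalk v p2 l" "awalk l q2 v"
    "path_weight G w p2 = cycle_pos n w l - cycle_pos n w v"
    "path_weight G w q2 = cycle_pos n w l - cycle_pos n w v"
    using cycle_walks_up[OF n l(1,2), of w] by (auto simp: G_def)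
  have "awalk 0 [(0, l)] l" "awalk l [(l, 0)] 0"
    using l unfolding awalk_simps by (auto simp: G_def cycle_graph_def)
  then have "awalk u (q1 @ [(0, l)] @ q2) v" "awalk v (p2 @ [(l, 0)] @ p1) u"
    using 1 2 awalk_appendI by blast+
  moreover have "cycle_pos n w n = cycle_pos n w l + w {l, 0}"
    using cycle_pos_Suc[of n w l] l by simp
  then have "path_weight G w (q1 @ [(0, l)] @ q2)
      = cycle_pos n w n - (cycle_pos n w v - cycle_pos n w u)"
    "path_weight G w (p2 @ [(l, 0)] @ p1)
      = cycle_pos n w n - (cycle_pos n w v - cycle_pos n w u)"
    using 1 2 cycle_pos_mono[OF assms(2), of n w] cycle_pos_mono[OF l(1), of n w]
    by (simp_all add: path_weight_def edge_of_def G_def insert_commute)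
  ultimately show ?thesis by blast
qed

text \<open>The two arcs between the vertices give the upper bound; \<open>le_wdist\<close>, applied
  to the circular distance, gives the lower one.\<close>

lemma wdist_cycle_graph:
  assumes n: "n \<ge> 3" and uv: "u < n" "v < n"
  shows "wdist (with_proj (cycle_graph n)) w u v
    = circ_dist (cycle_pos n w n) (cycle_pos n w u) (cycle_pos n w v)"
proof -
  define G where "G = with_proj (cycle_graph n)"
  define D where "D x y = circ_dist (cycle_pos n w n) (cycle_pos n w x) (cycle_pos n w y)" for x y
  interpret wf_digraph G
    unfolding G_def using n by (rule wf_digraph_cycle_graph)
  have upper: "wdist G w x y \<le> D x y" "wdist G w y x \<le> D x y" if "x \<le> y" "y < n" for x y
  proof -
    have eq: "D x y = min (cycle_pos n w y - cycle_pos n w x)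
        (cycle_pos n w n - (cycle_pos n w y - cycle_pos n w x))"
      unfolding D_def using that(1) by (intro circ_dist_le cycle_pos_mono)
    show "wdist G w x y \<le> D x y" "wdist G w y x \<le> D x y"
      unfolding eq using cycle_walks_up[OF n that, of w] cycle_walks_around[OF n that, of w]
      by (metis G_def min.boundedI wdist_le_path_weight)+
  qed
  have "D a b \<le> w (edge_of G (a, b))" if "(a, b) \<in> arcs G" for a b
  proof -
    have edge: "D i (Suc i mod n) \<le> w {i, Suc i mod n}" if "i < n" for i
    proof (cases "Suc i < n")
      case True
      then show ?thesis
        by (simp add: D_def circ_dist_le cycle_pos_Suc)
    next
      \<comment> \<open>For the closing edge, the weight is the second argument of
        \<open>min\<close>, the arc running through the end of the circle.\<close>
      case False
      with that have "Suc i = n" by simp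
      then show ?thesis
        using cycle_pos_Suc[of n w i]
        by (simp add: D_def circ_dist_def cycle_pos_0)
    qed
    from that consider "a < n" "b = Suc a mod n" | "b < n" "a = Suc b mod n"
      by (auto simp: G_def cycle_graph_def)
    then show ?thesis
      using edge[of a] edge[of b] circ_dist_commute
      by cases (auto simp: G_def edge_of_def insert_commute D_def)
  qed
  moreover obtain p where "awalk u p v"
    using cycle_walks_up[OF n, of u v w] cycle_walks_up[OF n, of v u w] uv
    unfolding G_def by (meson linear)
  moreover have "D x z \<le> D x y + D y z" if "x < n" "y < n" "z < n" for x y z
    unfolding D_def using that by (intro circ_dist_triangle cycle_pos_mono) auto
  moreover have "D x x = 0" for x
    by (simp add: D_def circ_dist_def)
  ultimately have "D u v \<le> wdist G w u v"
    by (intro le_wdist) (auto simp: G_def cycle_graph_def)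
  moreover have "wdist G w u v \<le> D u v"
    using upper uv circ_dist_commute unfolding D_def by (metis linear)
  ultimately show ?thesis
    unfolding D_def G_def by simp
qed

section \<open>The lower bound\<close>

text \<open>Among three bits two agree, so at most two of the three pairs differ in any
  coordinate.\<close>

lemma hamming_dist_triple_le:
  fixes xs ys zs :: "bool list"
  assumes "length xs = m" "length ys = m" "length zs = m"
  shows "hamming_dist xs ys + hamming_dist ys zs + hamming_dist zs xs \<le> 2 * m"
proof -
  have eq: "hamming_dist as bs = (\<Sum>i<m. of_bool (as ! i \<noteq> bs ! i))" if "length as = m"
    for as bs :: "bool list"
    using that by (simp add: hamming_dist_def Int_def lessThan_def sum.If_cases of_bool_def)
  have "hamming_dist xs ys + hamming_dist ys zs + hamming_dist zs xs
      = (\<Sum>i<m. of_bool (xs ! i \<noteq> ys ! i) + of_bool (ys ! i \<noteq> zs ! i) + of_bool (zs ! i \<noteq> xs ! i))"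
    by (simp add: eq assms sum.distrib)
  also have "\<dots> \<le> (\<Sum>i<m. 2)"
    by (intro sum_mono) auto
  finally show ?thesis by simp
qed

text \<open>Take \<open>j\<close> just before the halfway point is first passed. The arcs from 0 to
  \<open>P j\<close>, on to \<open>P (Suc j)\<close>, and back to 0 are then at most half the
  circle, so the distances are the arc lengths.\<close>

lemma balanced_triple:
  fixes P :: "nat \<Rightarrow> nat"
  assumes "n > 0" and P0: "P 0 = 0"
    and step: "\<And>i. i < n \<Longrightarrow> P i \<le> P (Suc i) \<and> 2 * (P (Suc i) - P i) \<le> P n"
  obtains j where "j < n"
    "circ_dist (P n) 0 (P j) + circ_dist (P n) (P j) (P (Suc j mod n))
      + circ_dist (P n) (P (Suc j mod n)) 0 = P n"
proof -
  have "\<exists>j<n. (\<forall>i\<le>j. 2 * P i \<le> P n) \<and> (Suc j = n \<or> P n < 2 * P (Suc j))"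
  proof (rule ccontr)
    assume neg: "\<not> ?thesis"
    \<comment> \<open>Without such a \<open>j\<close>, no vertex ever passes the halfway point, and
      \<open>j = n - 1\<close> is a contradiction.\<close>
    have "j < n \<longrightarrow> (\<forall>i\<le>j. 2 * P i \<le> P n)" for j
    proof (induction j)
      case (Suc j)
      with neg show ?case
        by (metis Suc_lessD le_SucE linorder_not_less order_less_irrefl)
    qed (simp add: P0)
    with neg \<open>n > 0\<close> show False
      by (metis Suc_pred' lessI)
  qed
  then obtain j where j: "j < n" "2 * P j \<le> P n" "Suc j = n \<or> P n < 2 * P (Suc j)"
    by auto
  from \<open>j < n\<close> have "Suc j \<le> n" by simp
  then have "P (Suc j) \<le> P n"
    by (induction rule: inc_induct) (use step order_trans in blast)+
  have left: "circ_dist (P n) 0 (P j) = P j"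
    using j(2) by (simp add: circ_dist_def)
  have "circ_dist (P n) 0 (P j) + circ_dist (P n) (P j) (P (Suc j mod n))
      + circ_dist (P n) (P (Suc j mod n)) 0 = P n"
  proof (cases "Suc j = n")
    \<comment> \<open>The triple degenerates to 0, \<open>P j\<close>, 0, with \<open>P j\<close>
      exactly halfway.\<close>
    case True
    with step[OF j(1)] have "P n - P j \<le> P j"
      by simp linarith
    then have "circ_dist (P n) (P j) 0 = P n - P j"
      by (simp add: circ_dist_def)
    with True left P0 j(2) show ?thesis
      by (simp add: circ_dist_def)
  next
    case False
    with j have "Suc j < n" "P n < 2 * P (Suc j)" by auto
    moreover from this have "circ_dist (P n) (P (Suc j)) 0 = P n - P (Suc j)"
      by (simp add: circ_dist_def)
    moreover have "circ_dist (P n) (P j) (P (Suc j)) = P (Suc j) - P j"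
      using step[OF j(1)] unfolding circ_dist_def by linarith
    ultimately show ?thesis
      using left step[OF j(1)] \<open>P (Suc j) \<le> P n\<close> by simp
  qed
  with j(1) that show thesis by blast
qed

section \<open>The addressing\<close>

text \<open>The vertex of \<open>{0,1}\<^sup>m\<close> reached after \<open>x\<close> steps around an isometric cycle of length \<open>2 m\<close>:
  the coordinates are first set to 1 one by one, then reset to 0 in the same order.\<close>

definition circle_code :: "nat \<Rightarrow> nat \<Rightarrow> bool list" where
  "circle_code m x = map (\<lambda>i. i < x \<and> x \<le> i + m) [0..<m]"

lemma circ_dist_le_hamming_dist_circle_code:
  assumes "x \<le> 2 * m" "y \<le> 2 * m"
  shows "circ_dist (2 * m) x y \<le> hamming_dist (circle_code m x) (circle_code m y)"
proof -
  define B where "B x y = {i. i < m \<and> (i < x \<and> x \<le> i + m) \<noteq> (i < y \<and> y \<le> i + m)}" for x y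
  have ham: "hamming_dist (circle_code m x) (circle_code m y) = card (B x y)" for x y
    unfolding hamming_dist_def B_def by (rule arg_cong[of _ _ card]) (auto simp: circle_code_def)
  have fin: "finite (B x y)" for x y
    by (simp add: B_def)
  have le: "circ_dist (2 * m) x y \<le> card (B x y)" if "x \<le> y" "y \<le> 2 * m" for x y
  proof -
    \<comment> \<open>Up to \<open>m\<close> the ones form the prefix below \<open>x\<close>; beyond
      \<open>m\<close> they form the suffix from \<open>y - m\<close>. In the mixed cases these are
      disjoint (3) or overlap (4), and the differing coordinates number
      \<open>2 * m - (y - x)\<close> or \<open>y - x\<close>.\<close>
    consider "y \<le> m" | "m < x" | "x \<le> m" "m < y" "x \<le> y - m" | "x \<le> m" "m < y" "y - m < x"
      by linarith
    then show ?thesis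
    proof cases
      case 1
      then have "card {x..<y} \<le> card (B x y)"
        by (intro card_mono fin) (auto simp: B_def)
      then show ?thesis using that by (simp add: circ_dist_le)
    next
      case 2
      then have "card {x - m..<y - m} \<le> card (B x y)"
        using that by (intro card_mono fin) (auto simp: B_def)
      then show ?thesis using that 2 by (simp add: circ_dist_le)
    next
      case 3
      then have "card ({..<x} \<union> {y - m..<m}) \<le> card (B x y)"
        using that by (intro card_mono fin) (auto simp: B_def)
      moreover have "card ({..<x} \<union> {y - m..<m}) = x + (m - (y - m))"
        using 3 by (subst card_Un_disjoint) auto
      ultimately show ?thesis using that 3 by (simp add: circ_dist_le)
    next
      case 4
      then have "card ({..<y - m} \<union> {x..<m}) \<le> card (B x y)"
        using that by (intro card_mono fin) (auto simp: B_def)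
      moreover have "card ({..<y - m} \<union> {x..<m}) = (y - m) + (m - x)"
        using 4 by (subst card_Un_disjoint) auto
      ultimately show ?thesis using that 4 by (simp add: circ_dist_le)
    qed
  qed
  have "B x y = B y x"
    by (auto simp: B_def)
  then show ?thesis
    using le[of x y] le[of y x] assms circ_dist_commute[of "2 * m" x y] ham[of x y]
    by (cases "x \<le> y") auto
qed

text \<open>This allows an odd total weight to be rounded up to the even length
  \<open>2 * m\<close>.\<close>

lemma circ_dist_mono: "S \<le> T \<Longrightarrow> circ_dist S x y \<le> circ_dist T x y"
  unfolding circ_dist_def by (intro min.mono diff_le_mono) auto

section \<open>The addressing number of the cycle\<close>

theorem theorem2:
  fixes n :: nat and w :: "nat set \<Rightarrow> nat"
  assumes "n \<ge> 3"
    and "\<forall>e \<in> edges (with_proj (cycle_graph n)). w e > 0"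
    and "\<forall>e \<in> edges (with_proj (cycle_graph n)).
           w e \<le> (\<Sum>e' \<in> edges (with_proj (cycle_graph n)) - {e}. w e')"
  shows "int (addressing_number (with_proj (cycle_graph n)) w) =
           \<lceil>real (\<Sum>e \<in> edges (with_proj (cycle_graph n)). w e) / 2\<rceil>"
proof -
  define G where "G = with_proj (cycle_graph n)"
  define P where "P = cycle_pos n w"
  define m where "m = (P n + 1) div 2"
  have verts: "verts G = {..<n}"
    by (simp add: G_def cycle_graph_def)
  have total: "(\<Sum>e \<in> edges G. w e) = P n"
    unfolding G_def P_def using assms(1) by (rule cycle_pos_total)
  have wdist: "wdist G w u v = circ_dist (P n) (P u) (P v)" if "u < n" "v < n" for u v
    unfolding G_def P_def using assms(1) that by (rule wdist_cycle_graph)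
  have "addressing_number G w = m"
    unfolding addressing_number_def
  proof (rule Least_equality)
    have "circ_dist (P n) (P u) (P v) \<le> hamming_dist (circle_code m (P u)) (circle_code m (P v))"
      if "u < n" "v < n" for u v
    proof -
      have "P u \<le> P n" "P v \<le> P n"
        using that by (auto simp: P_def intro: cycle_pos_mono)
      moreover have "P n \<le> 2 * m"
        by (simp add: m_def)
      ultimately show ?thesis
        using circ_dist_mono circ_dist_le_hamming_dist_circle_code by (meson order_trans)
    qed
    then have "binary_addressing G w m (\<lambda>v. circle_code m (P v))"
      by (simp add: binary_addressing_def verts wdist circle_code_def)
    then show "\<exists>f. binary_addressing G w m f"
      by blast
  next
    fix k assume "\<exists>f. binary_addressing G w k f"
    then obtain f where f: "binary_addressing G w k f"
      by blast
    then have len: "length (f v) = k" if "v < n" for v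
      using that by (simp add: binary_addressing_def verts)
    have dist: "circ_dist (P n) (P u) (P v) \<le> hamming_dist (f u) (f v)"
      if "u < n" "v < n" for u v
    proof -
      have "wdist G w u v \<le> hamming_dist (f u) (f v)"
        using f that by (simp add: binary_addressing_def verts)
      with wdist[OF that] show ?thesis by simp
    qed
    \<comment> \<open>The triangle inequality on the weights says exactly that no edge exceeds half
      the circle.\<close>
    have "P i \<le> P (Suc i) \<and> 2 * (P (Suc i) - P i) \<le> P n" if "i < n" for i
    proof -
      define e where "e = {i, Suc i mod n}"
      have e: "e \<in> edges G"
        using that by (auto simp: e_def G_def edges_cycle_graph)
      have "finite (edges G)"
        by (simp add: G_def edges_cycle_graph)
      then have "P n = w e + (\<Sum>e' \<in> edges G - {e}. w e')"
        using e total by (simp add: sum.remove)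
      moreover have "w e \<le> (\<Sum>e' \<in> edges G - {e}. w e')"
        using assms(3) e by (simp add: G_def)
      ultimately show ?thesis
        by (simp add: P_def cycle_pos_Suc e_def)
    qed
    then obtain j where j: "j < n" "circ_dist (P n) 0 (P j)
        + circ_dist (P n) (P j) (P (Suc j mod n)) + circ_dist (P n) (P (Suc j mod n)) 0 = P n"
      using balanced_triple[of n P] assms(1) by (auto simp: P_def cycle_pos_0)
    have P0: "P 0 = 0"
      by (simp add: P_def cycle_pos_0)
    have n: "0 < n" "Suc j mod n < n"
      using assms(1) by auto
    have "P n \<le> hamming_dist (f 0) (f j) + hamming_dist (f j) (f (Suc j mod n))
        + hamming_dist (f (Suc j mod n)) (f 0)"
      using dist[OF n(1) j(1)] dist[OF j(1) n(2)] dist[OF n(2,1)] j(2) P0 by simp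
    also have "\<dots> \<le> 2 * k"
      using len n j(1) by (intro hamming_dist_triple_le) auto
    finally show "m \<le> k"
      by (simp add: m_def)
  qed
  moreover have "int m = \<lceil>real (P n) / 2\<rceil>"
    unfolding m_def by (rule sym, rule ceiling_unique) (auto simp: field_simps real_of_nat_div)
  ultimately show ?thesis
    by (simp flip: G_def add: total)
qed

end
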